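(* Let $n\ge2$ and let $\mathbf A=(A,q,\mathsf e_1,\dots,\mathsf e_n)$ be an $n\mathrm{BA}$. A multideal of $\mathbf A$ is prime if and only if it is an ultramultideal.
   Context: Let $n\ge 2$. An $n\mathrm{BA}$ (Boolean-like algebra of dimension $n$) is an algebra $\mathbf A=(A,q,\mathsf e_1,\dots,\mathsf e_n)$ with $q$ of arity $n+1$ and constants $\mathsf e_1,\dots,\mathsf e_n$ satisfying the identities (B0) $q(\mathsf e_i,x^1,\dots,x^n)=x^i$ for $i=1,\dots,n$; (B1) $q(y,x,\dots,x)=x$; (B2) $q(y,q(y,x^{11},\dots,x^{1n}),\dots,q(y,x^{n1},\dots,x^{nn}))=q(y,x^{11},x^{22},\dots,x^{nn})$; (B3) $q(y,q(x^{10},\dots,x^{1n}),\dots,q(x^{n0},\dots,x^{nn}))=q(q(y,x^{10},\dots,x^{n0}),\dots,q(y,x^{1n},\dots,x^{nn}))$; (B4) $q(y,\mathsf e_1,\dots,\mathsf e_n)=y$. For $i\in\{1,\dots,n\}$, $x\land_i y=q(x,w_1,\dots,w_n)$ with $w_i=\mathsf e_i$ and $w_k=y$ for $k\ne i$. A multideal of $\mathbf A$ is a tuple $(I_1,\dots,I_n)$ of pairwise disjoint subsets of $A$ such that: (m1) $\mathsf e_k\in I_k$ for all $k$; (m2) if $a\in I_r$, $b\in I_k$ and $y_1,\dots,y_n\in A$, then $q(a,y_1,\dots,y_{r-1},b,y_{r+1},\dots,y_n)\in I_k$; (m3) if $a\in A$ and $y_1,\dots,y_n\in I_k$, then $q(a,y_1,\dots,y_n)\in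 I_k$. An ultramultideal is a multideal with $I_1\cup\dots\cup I_n=A$. A multideal $(I_1,\dots,I_n)$ is prime if, for every $i\in\{1,\dots,n\}$ and all $x,y\in A$, $x\land_i y\in I_i$ implies $x\in I_i$ or $y\in I_i$. *)

theory Defs
  imports "HOL-Library.FuncSet" "HOL-Library.Disjoint_Sets"
begin

text \<open>
  An \<open>n\<close>-tuple over \<open>A\<close> is an element of \<^term>\<open>{1..n} \<rightarrow>\<^sub>E A\<close>, so \<open>q(y, w\<^sub>1, \<dots>, w\<^sub>n)\<close> is
  written \<^term>\<open>q y (\<lambda>k\<in>{1..n}. w k)\<close>.  Since the restricted abstraction is extensional,
  the term depends only on \<open>w\<^sub>1, \<dots>, w\<^sub>n\<close>.  In the axioms \<open>B2\<close> and \<open>B3\<close>, the family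
  \<open>x\<^sup>i\<^sup>j\<close> is the curried function \<open>x i j\<close>.
\<close>

locale nBA =
  fixes n :: nat
    and A :: "'a set"
    and q :: "'a \<Rightarrow> (nat \<Rightarrow> 'a) \<Rightarrow> 'a"
    and e :: "nat \<Rightarrow> 'a"
  assumes dim: "2 \<le> n"
    and q_closed: "\<And>y w. \<lbrakk>y \<in> A; w \<in> {1..n} \<rightarrow>\<^sub>E A\<rbrakk> \<Longrightarrow> q y w \<in> A"
    and e_closed: "\<And>i. i \<in> {1..n} \<Longrightarrow> e i \<in> A"
    and B0: "\<And>i x. \<lbrakk>i \<in> {1..n}; x \<in> {1..n} \<rightarrow>\<^sub>E A\<rbrakk> \<Longrightarrow> q (e i) x = x i"
    and B1: "\<And>y x. \<lbrakk>y \<in> A; x \<in> A\<rbrakk> \<Longrightarrow> q y (\<lambda>k\<in>{1..n}. x) = x"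
    and B2: "\<And>y x. \<lbrakk>y \<in> A; \<And>i j. \<lbrakk>i \<in> {1..n}; j \<in> {1..n}\<rbrakk> \<Longrightarrow> x i j \<in> A\<rbrakk> \<Longrightarrow>
      q y (\<lambda>i\<in>{1..n}. q y (\<lambda>j\<in>{1..n}. x i j)) = q y (\<lambda>i\<in>{1..n}. x i i)"
    and B3: "\<And>y x. \<lbrakk>y \<in> A; \<And>i j. \<lbrakk>i \<in> {1..n}; j \<in> {0..n}\<rbrakk> \<Longrightarrow> x i j \<in> A\<rbrakk> \<Longrightarrow>
      q y (\<lambda>i\<in>{1..n}. q (x i 0) (\<lambda>j\<in>{1..n}. x i j)) =
      q (q y (\<lambda>i\<in>{1..n}. x i 0)) (\<lambda>j\<in>{1..n}. q y (\<lambda>i\<in>{1..n}. x i j))"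
    and B4: "\<And>y. y \<in> A \<Longrightarrow> q y (\<lambda>k\<in>{1..n}. e k) = y"

definition meet ::
  "nat \<Rightarrow> ('a \<Rightarrow> (nat \<Rightarrow> 'a) \<Rightarrow> 'a) \<Rightarrow> (nat \<Rightarrow> 'a) \<Rightarrow> nat \<Rightarrow> 'a \<Rightarrow> 'a \<Rightarrow> 'a"
  where "meet n q e i x y = q x (\<lambda>k\<in>{1..n}. if k = i then e i else y)"

text \<open>A tuple \<open>(I\<^sub>1, \<dots>, I\<^sub>n)\<close> of subsets is a function of which only the values on \<^term>\<open>{1..n}\<close> matter.\<close>

definition multideal ::
  "nat \<Rightarrow> 'a set \<Rightarrow> ('a \<Rightarrow> (nat \<Rightarrow> 'a) \<Rightarrow> 'a) \<Rightarrow> (nat \<Rightarrow> 'a) \<Rightarrow> (nat \<Rightarrow> 'a set) \<Rightarrow> bool"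
  where "multideal n A q e I \<longleftrightarrow>
    (\<forall>k\<in>{1..n}. I k \<subseteq> A) \<and>
    disjoint_family_on I {1..n} \<and>
    (\<forall>k\<in>{1..n}. e k \<in> I k) \<and>
    (\<forall>r\<in>{1..n}. \<forall>k\<in>{1..n}. \<forall>a\<in>I r. \<forall>b\<in>I k. \<forall>y\<in>{1..n} \<rightarrow>\<^sub>E A. q a (y(r := b)) \<in> I k) \<and>
    (\<forall>k\<in>{1..n}. \<forall>a\<in>A. \<forall>y\<in>{1..n} \<rightarrow>\<^sub>E I k. q a y \<in> I k)"

definition ultramultideal ::
  "nat \<Rightarrow> 'a set \<Rightarrow> ('a \<Rightarrow> (nat \<Rightarrow> 'a) \<Rightarrow> 'a) \<Rightarrow> (nat \<Rightarrow> 'a) \<Rightarrow> (nat \<Rightarrow> 'a set) \<Rightarrow> bool"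
  where "ultramultideal n A q e I \<longleftrightarrow>
    multideal n A q e I \<and> (\<Union>k\<in>{1..n}. I k) = A"

definition prime_multideal ::
  "nat \<Rightarrow> 'a set \<Rightarrow> ('a \<Rightarrow> (nat \<Rightarrow> 'a) \<Rightarrow> 'a) \<Rightarrow> (nat \<Rightarrow> 'a) \<Rightarrow> (nat \<Rightarrow> 'a set) \<Rightarrow> bool"
  where "prime_multideal n A q e I \<longleftrightarrow>
    multideal n A q e I \<and>
    (\<forall>i\<in>{1..n}. \<forall>x\<in>A. \<forall>y\<in>A. meet n q e i x y \<in> I i \<longrightarrow> x \<in> I i \<or> y \<in> I i)"

end

theory Submission
  imports Defs
begin

text \<open>
  Let \<open>x\<close> lie in no component of a prime multideal.  For \<open>i \<noteq> j\<close> the element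
  \<open>a = q(x, e\<^sub>i, \<dots>, e\<^sub>j, \<dots>, e\<^sub>i)\<close>, with \<open>e\<^sub>j\<close> at position \<open>i\<close>, satisfies \<open>x \<and>\<^sub>i a = e\<^sub>i\<close>, so
  primality puts \<open>a\<close> into \<open>I\<^sub>i\<close>.  If moreover \<open>b = q(x, w) \<in> I\<^sub>k\<close>, then \<open>m2\<close> gives
  \<open>q(a, \<dots>) \<in> I\<^sub>k\<close> for every tuple with \<open>b\<close> at position \<open>i\<close>; for a tuple with \<open>z\<close> at position \<open>j\<close>
  this element is \<open>q(x, w)\<close> with its \<open>i\<close>-th argument replaced by \<open>z\<close>.  Hence the membership
  \<open>q(x, w) \<in> I\<^sub>k\<close> does not depend on \<open>w\<close> at all, and \<open>e\<^sub>1 = q(x, e\<^sub>1, \<dots>, e\<^sub>1) \<in> I\<^sub>1\<close> turns into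
  \<open>e\<^sub>2 = q(x, e\<^sub>2, \<dots>, e\<^sub>2) \<in> I\<^sub>1\<close>, which contradicts disjointness.
\<close>

context nBA
begin

declare One_nat_def [simp del]

text \<open>\<open>B3\<close> for a matrix with column 0 equal to \<open>u\<close> and every row
  otherwise equal to \<open>c\<close>: each further column is constant, so \<open>B1\<close>
  collapses it to an entry of \<open>c\<close>.\<close>

lemma q_q_left:
  assumes "y \<in> A" "u \<in> {1..n} \<rightarrow> A" "c \<in> {1..n} \<rightarrow>\<^sub>E A"
  shows "q (q y (restrict u {1..n})) c = q y (\<lambda>i\<in>{1..n}. q (u i) c)"
proof -
  define x where "x i j = (if j = 0 then u i else c j)" for i j :: nat
  have "x i j \<in> A" if "i \<in> {1..n}" "j \<in> {0..n}" for i j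
    using that assms by (cases j) (auto simp: x_def Pi_iff)
  from B3 [of y x, OF \<open>y \<in> A\<close> this]
  have "q y (\<lambda>i\<in>{1..n}. q (u i) (\<lambda>j\<in>{1..n}. x i j)) =
    q (q y (restrict u {1..n})) (\<lambda>j\<in>{1..n}. q y (\<lambda>i\<in>{1..n}. x i j))"
    by (simp add: x_def)
  moreover have "(\<lambda>j\<in>{1..n}. x i j) = c" for i
    using assms(3) by (intro extensionalityI [of _ "{1..n}"]) (auto simp: x_def PiE_def)
  moreover have "(\<lambda>j\<in>{1..n}. q y (\<lambda>i\<in>{1..n}. x i j)) = c"
    using assms by (intro extensionalityI [of _ "{1..n}"]) (auto simp: x_def PiE_def B1 Pi_iff)
  ultimately show ?thesis by simp
qed

text \<open>\<open>B2\<close> for the matrix whose row \<open>i\<close> is constantly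
  \<open>z\<close> and whose other rows are \<open>w\<close>: \<open>B1\<close> evaluates row
  \<open>i\<close> to \<open>z\<close>, and the diagonal is \<open>w(i := z)\<close>.\<close>

lemma q_replace_others:
  assumes "y \<in> A" "z \<in> A" "w \<in> {1..n} \<rightarrow>\<^sub>E A" "i \<in> {1..n}"
  shows "q y (\<lambda>k\<in>{1..n}. if k = i then z else q y w) = q y (w(i := z))"
proof -
  define x where "x k j = (if k = i then z else w j)" for k j :: nat
  have "x k j \<in> A" if "k \<in> {1..n}" "j \<in> {1..n}" for k j
    using that assms by (auto simp: x_def)
  note B2 [of y x, OF \<open>y \<in> A\<close> this]
  moreover have "q y (\<lambda>j\<in>{1..n}. x k j) = (if k = i then z else q y w)" for k
    using assms by (auto simp: x_def B1 PiE_restrict)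
  moreover have "(\<lambda>k\<in>{1..n}. x k k) = w(i := z)"
    using assms by (intro extensionalityI [of _ "{1..n}"]) (auto simp: x_def PiE_def extensional_def)
  ultimately show ?thesis by simp
qed

lemma meet_complement:
  assumes "x \<in> A" "z \<in> A" "i \<in> {1..n}"
  shows "meet n q e i x (q x (\<lambda>k\<in>{1..n}. if k = i then z else e i)) = e i"
proof -
  have "meet n q e i x (q x (\<lambda>k\<in>{1..n}. if k = i then z else e i)) =
    q x ((\<lambda>k\<in>{1..n}. if k = i then z else e i)(i := e i))"
    unfolding meet_def using assms e_closed by (intro q_replace_others) auto
  also have "(\<lambda>k\<in>{1..n}. if k = i then z else e i)(i := e i) = (\<lambda>k\<in>{1..n}. e i)"
    using assms by auto
  also have "q x \<dots> = e i" using assms e_closed by (intro B1)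
  finally show ?thesis .
qed

lemma q_q_switch:
  assumes "x \<in> A" "z \<in> A" "w \<in> {1..n} \<rightarrow>\<^sub>E A" "i \<in> {1..n}" "j \<in> {1..n}" "i \<noteq> j"
  shows "q (q x (\<lambda>k\<in>{1..n}. if k = i then e j else e i)) ((\<lambda>k\<in>{1..n}. z)(i := q x w)) =
    q x (w(i := z))" (is "q (q x (restrict ?u _)) ?c = _")
proof -
  have c: "?c \<in> {1..n} \<rightarrow>\<^sub>E A"
    using assms q_closed by (auto simp: PiE_def extensional_def)
  have "q (q x (restrict ?u {1..n})) ?c = q x (\<lambda>k\<in>{1..n}. q (?u k) ?c)"
    using assms e_closed c by (intro q_q_left) auto
  \<comment> \<open>By \<open>B0\<close>, \<open>e j\<close> selects \<open>z\<close> because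
    \<open>i \<noteq> j\<close>, while \<open>e i\<close> selects \<open>q x w\<close>.\<close>
  also have "(\<lambda>k\<in>{1..n}. q (?u k) ?c) = (\<lambda>k\<in>{1..n}. if k = i then z else q x w)"
    using assms by (auto simp: B0 [OF _ c] intro!: restrict_ext)
  also have "q x \<dots> = q x (w(i := z))" using assms by (intro q_replace_others)
  finally show ?thesis .
qed

lemma prime_multideal_q_update:
  assumes P: "prime_multideal n A q e I"
    and x: "x \<in> A" "x \<notin> I i"
    and w: "w \<in> {1..n} \<rightarrow>\<^sub>E A" "q x w \<in> I k"
    and "i \<in> {1..n}" "k \<in> {1..n}" "z \<in> A"
  shows "q x (w(i := z)) \<in> I k"
proof -
  have M: "multideal n A q e I" using P by (simp add: prime_multideal_def)
  obtain j where j: "j \<in> {1..n}" "i \<noteq> j"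
  proof (cases "i = 1")
    case True
    then show ?thesis using dim that [of 2] by auto
  next
    case False
    then show ?thesis using dim that [of 1] by auto
  qed
  let ?a = "q x (\<lambda>k\<in>{1..n}. if k = i then e j else e i)"
  have "meet n q e i x ?a \<in> I i"
    using M assms j e_closed by (simp add: meet_complement multideal_def)
  moreover have "?a \<in> A" using assms j e_closed by (intro q_closed) auto
  ultimately have "?a \<in> I i" using P assms unfolding prime_multideal_def by blast
  moreover have "(\<lambda>k\<in>{1..n}. z) \<in> {1..n} \<rightarrow>\<^sub>E A" using assms by auto
  ultimately have "q ?a ((\<lambda>k\<in>{1..n}. z)(i := q x w)) \<in> I k"
    using M assms unfolding multideal_def by blast
  then show ?thesis using assms j by (simp add: q_q_switch)
qed

lemma prime_multideal_covers:
  assumes P: "prime_multideal n A q e I" and x: "x \<in> A"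
  shows "\<exists>i\<in>{1..n}. x \<in> I i"
proof (rule ccontr)
  assume "\<not> ?thesis"
  then have nin: "x \<notin> I i" if "i \<in> {1..n}" for i using that by blast
  have M: "multideal n A q e I" using P by (simp add: prime_multideal_def)
  have e12: "e 1 \<in> A" "e 2 \<in> A" using dim by (auto intro: e_closed)
  \<comment> \<open>The constant tuple \<open>e 1\<close> becomes the constant tuple
    \<open>e 2\<close> one position at a time; overwriting position \<open>Suc m\<close> relies on
    \<open>x \<notin> I (Suc m)\<close>.\<close>
  have "q x (\<lambda>k\<in>{1..n}. if k \<le> m then e 2 else e 1) \<in> I 1" if "m \<le> n" for m
    using that
  proof (induction m)
    case 0
    have "(\<lambda>k\<in>{1..n}. if k \<le> 0 then e 2 else e 1) = (\<lambda>k\<in>{1..n}. e 1)"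
      by (auto intro!: restrict_ext)
    then have "q x (\<lambda>k\<in>{1..n}. if k \<le> 0 then e 2 else e 1) = e 1"
      using B1 [OF x e12(1)] by metis
    moreover have "e 1 \<in> I 1" using M dim by (auto simp: multideal_def)
    ultimately show ?case by metis
  next
    case (Suc m)
    let ?w = "\<lambda>k\<in>{1..n}. if k \<le> m then e 2 else e 1"
    have "q x ?w \<in> I 1" using Suc.IH Suc.prems by (meson Suc_leD)
    moreover have "?w \<in> {1..n} \<rightarrow>\<^sub>E A" using e12 by auto
    moreover have "Suc m \<in> {1..n}" "1 \<in> {1..n}" using Suc.prems by auto
    ultimately have "q x (?w(Suc m := e 2)) \<in> I 1"
      using prime_multideal_q_update [OF P x nin] e12 by blast
    also have "?w(Suc m := e 2) = (\<lambda>k\<in>{1..n}. if k \<le> Suc m then e 2 else e 1)"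
      using Suc.prems by (auto simp: fun_eq_iff)
    finally show ?case .
  qed
  from this [of n] have "q x (\<lambda>k\<in>{1..n}. if k \<le> n then e 2 else e 1) \<in> I 1" by simp
  also have "(\<lambda>k\<in>{1..n}. if k \<le> n then e 2 else e 1) = (\<lambda>k\<in>{1..n}. e 2)"
    by (auto intro!: restrict_ext)
  also have "q x \<dots> = e 2" using x e12 by (intro B1)
  finally have "e 2 \<in> I 1" .
  moreover have "e 2 \<in> I 2" using M dim by (auto simp: multideal_def)
  moreover have "I 1 \<inter> I 2 = {}"
    using M dim disjoint_family_onD [of I "{1..n}" 1 2] by (simp add: multideal_def)
  ultimately show False by blast
qed

text \<open>If \<open>x \<in> I r\<close> with \<open>r \<noteq> i\<close>, the tuple of the meet
  already has \<open>y\<close> at position \<open>r\<close>, so \<open>m2\<close> puts the meet into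
  the component of \<open>y\<close>; disjointness makes that component \<open>I i\<close>.\<close>

lemma ultramultideal_meetD:
  assumes U: "ultramultideal n A q e I"
    and "i \<in> {1..n}" "x \<in> A" "y \<in> A" and meet: "meet n q e i x y \<in> I i"
  shows "x \<in> I i \<or> y \<in> I i"
proof -
  have M: "multideal n A q e I" using U by (simp add: ultramultideal_def)
  obtain r s where r: "r \<in> {1..n}" "x \<in> I r" and s: "s \<in> {1..n}" "y \<in> I s"
    using U assms unfolding ultramultideal_def by blast
  show ?thesis
  proof (cases "r = i")
    case False
    let ?w = "\<lambda>k\<in>{1..n}. if k = i then e i else y"
    have "?w \<in> {1..n} \<rightarrow>\<^sub>E A" using assms e_closed by auto
    then have "q x (?w(r := y)) \<in> I s"
      using M r s unfolding multideal_def by blast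
    moreover have "?w(r := y) = ?w" using False r by auto
    ultimately have "meet n q e i x y \<in> I s" by (simp add: meet_def)
    with meet have "s = i"
      using M s assms disjoint_family_onD [of I "{1..n}" s i] by (auto simp: multideal_def)
    with s show ?thesis by simp
  qed (use r in simp)
qed

end

theorem proposition7p13:
  fixes n :: nat
    and A :: "'a set"
    and q :: "'a \<Rightarrow> (nat \<Rightarrow> 'a) \<Rightarrow> 'a"
    and e :: "nat \<Rightarrow> 'a"
    and I :: "nat \<Rightarrow> 'a set"
  assumes "nBA n A q e"
    and "multideal n A q e I"
  shows "prime_multideal n A q e I \<longleftrightarrow> ultramultideal n A q e I"
proof -
  interpret nBA n A q e by fact
  show ?thesis
  proof
    assume "prime_multideal n A q e I"
    then have "A \<subseteq> (\<Union>k\<in>{1..n}. I k)" using prime_multideal_covers by blast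
    moreover have "(\<Union>k\<in>{1..n}. I k) \<subseteq> A" using assms(2) by (auto simp: multideal_def)
    ultimately show "ultramultideal n A q e I"
      using assms(2) by (auto simp: ultramultideal_def)
  next
    assume "ultramultideal n A q e I"
    then show "prime_multideal n A q e I"
      using assms(2) ultramultideal_meetD unfolding prime_multideal_def by blast
  qed
qed

end
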